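(* Assume that the well-balanced semi-discrete method $$\frac{dU_i}{dt}+\frac{1}{\Delta x}\left(\widehat{\mathcal F}_{i,i+1/2}-\widehat{\mathcal F}_{i,i-1/2}\right)=0$$ described in the context is well-defined, that the reconstruction operator $\mathcal R$ has order of accuracy $k$, and that the stationary solutions of $U_t+F(U)_x=S(U)H_x$ are smooth. Then the method has order of accuracy $k$: for every smooth solution $U(x,t)$ of $U_t+F(U)_x=S(U)H_x$, every time $t$ and every point $\bar x$ at which $H$ is differentiable, if for each $\Delta x$ the mesh has $x_i=\bar x$ as a node and the numerical fluxes $\widehat{\mathcal F}_{i,i\pm1/2}$ are computed from the exact point values $U_j=U(x_j,t)$, then $$\partial_tU(x_i,t)+\frac{1}{\Delta x}\left(\widehat{\mathcal F}_{i,i+1/2}-\widehat{\mathcal F}_{i,i-1/2}\right)=O(\Delta x^k)\qquad\text{as }\Delta x\to0 .$$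
   Context: Setting. $\Omega\subset\mathbb R^N$ is open, $F:\Omega\to\mathbb R^N$ (flux) and $S:\Omega\to\mathbb R^N$ are smooth, the Jacobian $J(U)$ of $F$ has $N$ distinct real eigenvalues, all different from $0$, for every $U\in\Omega$, and $H:\mathbb R\to\mathbb R$ is continuous and a.e. differentiable. The system of balance laws is $U_t+F(U)_x=S(U)H_x$ with unknown $U(x,t)\in\Omega$. A stationary solution on an interval is a locally absolutely continuous function $U^*$ with values in $\Omega$ satisfying $\frac{d}{dx}F(U^*(x))=S(U^*(x))H_x(x)$ at every point of the interval where $H$ is differentiable. Mesh. Uniform nodes $x_j$ with step $\Delta x$ ($x_{j+1}-x_j=\Delta x$), $x_{j+1/2}=x_j+\Delta x/2$. Reconstruction operator. Fix integers $r,s\ge0$ and a map $\mathcal R:(\mathbb R^N)^{r+s+1}\to\mathbb R^N$. It has order of accuracy $k$ if, for every smooth function $g$ with values in $\mathbb R^N$ and every point $x_i$ in (the interior of) its domain, $$\frac{1}{\Delta x}\Big(\mathcal R(g(x_{i-r}),\dots,g(x_{i+s}))-\mathcal R(g(x_{i-1-r}),\dots,g(x_{i-1+s}))\Big)=g'(x_i)+O(\Delta x^k)$$ as $\Delta x\to0$ with $x_i$ fixed. Numerical fluxes. Given values $U_j\in\Omega$ at the nodes, for each $i$: (1) let $U_i^*$ be the stationary solution with $U_i^*(x_i)=U_i$; (2) put $\mathcal F_j=F(U_j)-F(U_i^*(x_j))$ for $j=i-1-r,\dots,i+s$; (3) put $\widehat{\mathcal F}_{i,i+1/2}=\mathcal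 R(\mathcal F_{i-r},\dots,\mathcal F_{i+s})$ and $\widehat{\mathcal F}_{i,i-1/2}=\mathcal R(\mathcal F_{i-1-r},\dots,\mathcal F_{i-1+s})$. The method is well-defined if, for every $i$, the Cauchy problem in (1) has a unique solution whose interval of definition contains $x_{i-r-1},\dots,x_{i+s}$. *)

theory Defs
  imports "HOL-Analysis.Analysis" "HOL-Library.Landau_Symbols"
begin

section \<open>Smooth and locally absolutely continuous functions\<close>

text \<open>On an open set, \<open>n\<close>-fold continuous differentiability, by recursion over the
  directional derivatives of the (total) derivative.\<close>

primrec cont_diff_on ::
    "'a::real_normed_vector set \<Rightarrow> ('a \<Rightarrow> 'b::real_normed_vector) \<Rightarrow> nat \<Rightarrow> bool" where
  "cont_diff_on A f 0 \<longleftrightarrow> continuous_on A f"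
| "cont_diff_on A f (Suc n) \<longleftrightarrow>
     (\<forall>x\<in>A. f differentiable (at x)) \<and>
     (\<forall>v. cont_diff_on A (\<lambda>x. frechet_derivative f (at x) v) n)"

text \<open>As usual, a function on a set that need not be open (such as an interval containing an end
  point) is smooth if it has a smooth extension to an open set. If \<open>A\<close> is open this amounts to
  \<open>cont_diff_on A f n\<close> for all \<open>n\<close>.\<close>

definition smooth_on ::
    "'a::real_normed_vector set \<Rightarrow> ('a \<Rightarrow> 'b::real_normed_vector) \<Rightarrow> bool" where
  "smooth_on A f \<longleftrightarrow>
     (\<exists>B g. open B \<and> A \<subseteq> B \<and> (\<forall>n. cont_diff_on B g n) \<and> (\<forall>x\<in>A. g x = f x))"

definition abs_continuous_on_interval ::
    "real \<Rightarrow> real \<Rightarrow> (real \<Rightarrow> 'b::real_normed_vector) \<Rightarrow> bool" where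
  "abs_continuous_on_interval a b f \<longleftrightarrow>
     (\<forall>\<epsilon>>0. \<exists>\<delta>>0. \<forall>P :: (real \<times> real) set.
        finite P \<and> (\<forall>(c, d)\<in>P. a \<le> c \<and> c \<le> d \<and> d \<le> b) \<and>
        disjoint_family_on (\<lambda>(c, d). {c<..<d}) P \<and> (\<Sum>(c, d)\<in>P. d - c) < \<delta>
        \<longrightarrow> (\<Sum>(c, d)\<in>P. norm (f d - f c)) < \<epsilon>)"

definition locally_abs_continuous_on ::
    "real set \<Rightarrow> (real \<Rightarrow> 'b::real_normed_vector) \<Rightarrow> bool" where
  "locally_abs_continuous_on I f \<longleftrightarrow>
     (\<forall>a b. a \<le> b \<and> {a..b} \<subseteq> I \<longrightarrow> abs_continuous_on_interval a b f)"

section \<open>Systems of balance laws\<close>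

definition real_eigenvalues :: "real^'n^'n \<Rightarrow> real set" where
  "real_eigenvalues M = {\<mu>. \<exists>v. v \<noteq> 0 \<and> M *v v = \<mu> *\<^sub>R v}"

text \<open>An \<open>N \<times> N\<close> matrix has at most \<open>N\<close> eigenvalues, so the cardinality condition says that there
  are \<open>N\<close> distinct ones and that all of them are real.\<close>

definition balance_law_data ::
    "(real^'n) set \<Rightarrow> (real^'n \<Rightarrow> real^'n) \<Rightarrow> (real^'n \<Rightarrow> real^'n) \<Rightarrow> (real \<Rightarrow> real) \<Rightarrow> bool" where
  "balance_law_data \<Omega> F S H \<longleftrightarrow>
     open \<Omega> \<and> smooth_on \<Omega> F \<and> smooth_on \<Omega> S \<and>
     (\<forall>U\<in>\<Omega>. card (real_eigenvalues (jacobian F (at U))) = CARD('n) \<and>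
             0 \<notin> real_eigenvalues (jacobian F (at U))) \<and>
     continuous_on UNIV H \<and> (AE x in lebesgue. H differentiable (at x))"

definition smooth_solution ::
    "(real^'n) set \<Rightarrow> (real^'n \<Rightarrow> real^'n) \<Rightarrow> (real^'n \<Rightarrow> real^'n) \<Rightarrow> (real \<Rightarrow> real) \<Rightarrow>
     (real \<times> real) set \<Rightarrow> (real \<Rightarrow> real \<Rightarrow> real^'n) \<Rightarrow> bool" where
  "smooth_solution \<Omega> F S H D U \<longleftrightarrow>
     open D \<and> smooth_on D (\<lambda>(x, t). U x t) \<and> (\<forall>(x, t)\<in>D. U x t \<in> \<Omega>) \<and>
     (\<forall>(x, t)\<in>D. H differentiable (at x) \<longrightarrow>
        vector_derivative (\<lambda>\<tau>. U x \<tau>) (at t) + vector_derivative (\<lambda>\<xi>. F (U \<xi> t)) (at x)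
          = deriv H x *\<^sub>R S (U x t))"

definition stationary_solution ::
    "(real^'n) set \<Rightarrow> (real^'n \<Rightarrow> real^'n) \<Rightarrow> (real^'n \<Rightarrow> real^'n) \<Rightarrow> (real \<Rightarrow> real) \<Rightarrow>
     real set \<Rightarrow> (real \<Rightarrow> real^'n) \<Rightarrow> bool" where
  "stationary_solution \<Omega> F S H I V \<longleftrightarrow>
     is_interval I \<and> locally_abs_continuous_on I V \<and> (\<forall>x\<in>I. V x \<in> \<Omega>) \<and>
     (\<forall>x\<in>I. H differentiable (at x) \<longrightarrow>
        ((\<lambda>y. F (V y)) has_vector_derivative deriv H x *\<^sub>R S (V x)) (at x within I))"

section \<open>The well-balanced semi-discrete method\<close>

definition uniform_mesh :: "real \<Rightarrow> (int \<Rightarrow> real) \<Rightarrow> bool" where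
  "uniform_mesh h x \<longleftrightarrow> (\<forall>j. x (j + 1) - x j = h)"

text \<open>A reconstruction operator acts on lists; only its values on lists of length \<open>r + s + 1\<close>
  matter. \<open>reconstruct R r s v i\<close> is its value on \<open>v (i - r), \<dots>, v (i + s)\<close>.\<close>

definition reconstruct ::
    "((real^'n) list \<Rightarrow> real^'n) \<Rightarrow> nat \<Rightarrow> nat \<Rightarrow> (int \<Rightarrow> real^'n) \<Rightarrow> int \<Rightarrow> real^'n" where
  "reconstruct R r s v i = R (map v [i - int r..i + int s])"

definition reconstruction_order ::
    "((real^'n) list \<Rightarrow> real^'n) \<Rightarrow> nat \<Rightarrow> nat \<Rightarrow> nat \<Rightarrow> bool" where
  "reconstruction_order R r s k \<longleftrightarrow>
     (\<forall>A g z. smooth_on A g \<and> z \<in> interior A \<longrightarrow>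
        (\<lambda>h. norm ((1 / h) *\<^sub>R (reconstruct R r s (\<lambda>j. g (z + of_int j * h)) 0
                               - reconstruct R r s (\<lambda>j. g (z + of_int j * h)) (-1))
                   - vector_derivative g (at z)))
          \<in> O[at_right 0](\<lambda>h. h ^ k))"

definition stencil :: "nat \<Rightarrow> nat \<Rightarrow> int \<Rightarrow> int set" where
  "stencil r s i = {i - 1 - int r..i + int s}"

text \<open>\<open>V\<close>, with interval of definition \<open>I\<close>, solves the Cauchy problem posed at node \<open>i\<close>, and \<open>I\<close>
  contains the nodes of the stencil.\<close>

definition stencil_solution ::
    "(real^'n) set \<Rightarrow> (real^'n \<Rightarrow> real^'n) \<Rightarrow> (real^'n \<Rightarrow> real^'n) \<Rightarrow> (real \<Rightarrow> real) \<Rightarrow>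
     nat \<Rightarrow> nat \<Rightarrow> (int \<Rightarrow> real) \<Rightarrow> (int \<Rightarrow> real^'n) \<Rightarrow> int \<Rightarrow> real set \<Rightarrow> (real \<Rightarrow> real^'n) \<Rightarrow> bool"
  where
  "stencil_solution \<Omega> F S H r s x u i I V \<longleftrightarrow>
     stationary_solution \<Omega> F S H I V \<and> V (x i) = u i \<and> x ` stencil r s i \<subseteq> I"

text \<open>\<open>A\<close> is the spatial domain on which point values \<open>u j\<close> are given (\<open>x j \<in> A\<close>); the numerical
  fluxes at node \<open>i\<close> only make sense if its whole stencil lies in \<open>A\<close>. If \<open>A\<close> is the real line,
  all nodes are considered.\<close>

definition well_defined_method ::
    "(real^'n) set \<Rightarrow> (real^'n \<Rightarrow> real^'n) \<Rightarrow> (real^'n \<Rightarrow> real^'n) \<Rightarrow> (real \<Rightarrow> real) \<Rightarrow>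
     nat \<Rightarrow> nat \<Rightarrow> real set \<Rightarrow> (int \<Rightarrow> real) \<Rightarrow> (int \<Rightarrow> real^'n) \<Rightarrow> bool" where
  "well_defined_method \<Omega> F S H r s A x u \<longleftrightarrow>
     (\<forall>i. x ` stencil r s i \<subseteq> A \<longrightarrow>
        (\<exists>I V. stencil_solution \<Omega> F S H r s x u i I V) \<and>
        (\<forall>I V J W. stencil_solution \<Omega> F S H r s x u i I V \<and>
                    stencil_solution \<Omega> F S H r s x u i J W \<longrightarrow> (\<forall>y\<in>I \<inter> J. V y = W y)))"

text \<open>If the method is well-defined, the values of \<open>local_stationary\<close> at the nodes of the stencil,
  which are the only ones used, do not depend on the choice made by \<open>SOME\<close>.\<close>

definition local_stationary ::
    "(real^'n) set \<Rightarrow> (real^'n \<Rightarrow> real^'n) \<Rightarrow> (real^'n \<Rightarrow> real^'n) \<Rightarrow> (real \<Rightarrow> real) \<Rightarrow>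
     nat \<Rightarrow> nat \<Rightarrow> (int \<Rightarrow> real) \<Rightarrow> (int \<Rightarrow> real^'n) \<Rightarrow> int \<Rightarrow> real \<Rightarrow> real^'n" where
  "local_stationary \<Omega> F S H r s x u i = (SOME V. \<exists>I. stencil_solution \<Omega> F S H r s x u i I V)"

definition flux_fluctuation ::
    "(real^'n) set \<Rightarrow> (real^'n \<Rightarrow> real^'n) \<Rightarrow> (real^'n \<Rightarrow> real^'n) \<Rightarrow> (real \<Rightarrow> real) \<Rightarrow>
     nat \<Rightarrow> nat \<Rightarrow> (int \<Rightarrow> real) \<Rightarrow> (int \<Rightarrow> real^'n) \<Rightarrow> int \<Rightarrow> int \<Rightarrow> real^'n" where
  "flux_fluctuation \<Omega> F S H r s x u i j = F (u j) - F (local_stationary \<Omega> F S H r s x u i (x j))"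

definition numerical_flux_right ::
    "((real^'n) list \<Rightarrow> real^'n) \<Rightarrow>
     (real^'n) set \<Rightarrow> (real^'n \<Rightarrow> real^'n) \<Rightarrow> (real^'n \<Rightarrow> real^'n) \<Rightarrow> (real \<Rightarrow> real) \<Rightarrow>
     nat \<Rightarrow> nat \<Rightarrow> (int \<Rightarrow> real) \<Rightarrow> (int \<Rightarrow> real^'n) \<Rightarrow> int \<Rightarrow> real^'n" where
  "numerical_flux_right R \<Omega> F S H r s x u i =
     reconstruct R r s (flux_fluctuation \<Omega> F S H r s x u i) i"

definition numerical_flux_left ::
    "((real^'n) list \<Rightarrow> real^'n) \<Rightarrow>
     (real^'n) set \<Rightarrow> (real^'n \<Rightarrow> real^'n) \<Rightarrow> (real^'n \<Rightarrow> real^'n) \<Rightarrow> (real \<Rightarrow> real) \<Rightarrow>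
     nat \<Rightarrow> nat \<Rightarrow> (int \<Rightarrow> real) \<Rightarrow> (int \<Rightarrow> real^'n) \<Rightarrow> int \<Rightarrow> real^'n" where
  "numerical_flux_left R \<Omega> F S H r s x u i =
     reconstruct R r s (flux_fluctuation \<Omega> F S H r s x u i) (i - 1)"

end

(* Write V for the stationary solution through (xbar, U(xbar, t)) obtained for one small step h0.
   Its interval contains the stencils of all smaller steps, so by uniqueness V serves every
   h < h0, and the fluctuations are the nodal values of the single function
   G = F(U(., t)) - F(V). Hence the order of the reconstruction applies to G, and
   G'(xbar) = F(U)_x - S(U) H_x = - U_t by the balance law. If s = 0, xbar may be an end point of
   the interval of V; then V is replaced by a smooth extension, whose derivative at xbar
   is determined by the one-sided one. *)

theory Submission
  imports Defs
begin

section \<open>Calculus of continuously differentiable functions\<close>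

lemma cont_diff_on_subset:
  "cont_diff_on A f n \<Longrightarrow> B \<subseteq> A \<Longrightarrow> cont_diff_on B f n"
  by (induction n arbitrary: f) (auto intro: continuous_on_subset)

lemma cont_diff_on_continuous: "cont_diff_on A f n \<Longrightarrow> continuous_on A f"
  by (cases n) (auto intro!: continuous_at_imp_continuous_on differentiable_imp_continuous_within)

lemma cont_diff_on_SucD: "cont_diff_on A f (Suc n) \<Longrightarrow> cont_diff_on A f n"
proof (induction n arbitrary: f)
  case 0
  then show ?case using cont_diff_on_continuous[OF 0] by simp
next
  case (Suc n)
  then show ?case by (metis cont_diff_on.simps(2))
qed

text \<open>On an open set the values of a function determine its derivative at every point, so
  agreement passes to the directional derivatives and the induction goes through.\<close>

lemma cont_diff_on_cong:
  assumes "open A" and "\<And>x. x \<in> A \<Longrightarrow> f x = g x" and "cont_diff_on A f n"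
  shows "cont_diff_on A g n"
  using assms(2,3)
proof (induction n arbitrary: f g)
  case 0
  then show ?case by (metis cont_diff_on.simps(1) continuous_on_cong)
next
  case (Suc n)
  have d: "(g has_derivative frechet_derivative f (at x)) (at x)" if "x \<in> A" for x
    using Suc.prems that \<open>open A\<close>
    by (metis cont_diff_on.simps(2) frechet_derivative_works has_derivative_transform_within_open)
  then have e: "frechet_derivative g (at x) = frechet_derivative f (at x)" if "x \<in> A" for x
    using that frechet_derivative_at by metis
  have "cont_diff_on A (\<lambda>x. frechet_derivative g (at x) v) n" for v
    by (rule Suc.IH[where f = "\<lambda>x. frechet_derivative f (at x) v"]) (use Suc.prems e in auto)
  then show ?case using d by (auto simp: differentiable_def)
qed

text \<open>Lets any expression \<open>f'\<close> produced by a differentiation rule replace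
  \<open>frechet_derivative\<close>; the closure properties below feed the sum, product and chain
  rules into it.\<close>

lemma cont_diff_on_SucI:
  assumes "open A" and d: "\<And>x. x \<in> A \<Longrightarrow> (f has_derivative f' x) (at x)"
    and "\<And>v. cont_diff_on A (\<lambda>x. f' x v) n"
  shows "cont_diff_on A f (Suc n)"
proof -
  have e: "f' x = frechet_derivative f (at x)" if "x \<in> A" for x
    using d[OF that] by (rule frechet_derivative_at)
  have "cont_diff_on A (\<lambda>x. frechet_derivative f (at x) v) n" for v
    by (rule cont_diff_on_cong[where f = "\<lambda>x. f' x v"]) (use assms e in auto)
  then show ?thesis using d by (auto simp: differentiable_def)
qed

lemma cont_diff_on_has_derivative:
  "cont_diff_on A f (Suc n) \<Longrightarrow> x \<in> A \<Longrightarrow>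
    (f has_derivative frechet_derivative f (at x)) (at x)"
  by (simp add: frechet_derivative_works)

lemma cont_diff_on_const: "open A \<Longrightarrow> cont_diff_on A (\<lambda>x. c) n"
proof (induction n arbitrary: c)
  case (Suc n)
  then show ?case by (intro cont_diff_on_SucI[where f' = "\<lambda>_ _. 0"]) auto
qed simp

lemma cont_diff_on_add:
  "open A \<Longrightarrow> cont_diff_on A f n \<Longrightarrow> cont_diff_on A g n \<Longrightarrow> cont_diff_on A (\<lambda>x. f x + g x) n"
proof (induction n arbitrary: f g)
  case 0
  then show ?case by (auto intro: continuous_intros)
next
  case (Suc n)
  then show ?case
    by (intro cont_diff_on_SucI[OF Suc.prems(1)
          has_derivative_add[OF cont_diff_on_has_derivative cont_diff_on_has_derivative]])
       (auto intro: Suc.IH)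
qed

lemma cont_diff_on_sum:
  assumes "open A" "finite T" "\<And>b. b \<in> T \<Longrightarrow> cont_diff_on A (f b) n"
  shows "cont_diff_on A (\<lambda>x. \<Sum>b\<in>T. f b x) n"
  using assms(2,3)
  by (induction T) (auto intro!: cont_diff_on_add cont_diff_on_const assms(1))

lemma cont_diff_on_bounded_linear:
  assumes "bounded_linear l" "open A" "cont_diff_on A f n"
  shows "cont_diff_on A (\<lambda>x. l (f x)) n"
  using assms(3)
proof (induction n arbitrary: f)
  case 0
  then show ?case using assms(1) by (auto intro: bounded_linear.continuous_on)
next
  case (Suc n)
  then show ?case
    by (intro cont_diff_on_SucI[OF assms(2)
          bounded_linear.has_derivative[OF assms(1) cont_diff_on_has_derivative]])
       (auto intro: Suc.IH)
qed

lemma cont_diff_on_diff: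
  "open A \<Longrightarrow> cont_diff_on A f n \<Longrightarrow> cont_diff_on A g n \<Longrightarrow> cont_diff_on A (\<lambda>x. f x - g x) n"
  using cont_diff_on_add[of A f n "\<lambda>x. - g x"]
    cont_diff_on_bounded_linear[OF bounded_linear_minus[OF bounded_linear_ident], of A g n]
  by simp

lemma cont_diff_on_bilinear:
  assumes "bounded_bilinear p" "open A" "cont_diff_on A f n" "cont_diff_on A g n"
  shows "cont_diff_on A (\<lambda>x. p (f x) (g x)) n"
  using assms(3,4)
proof (induction n arbitrary: f g)
  case 0
  then show ?case using assms(1) by (auto intro: bounded_bilinear.continuous_on)
next
  case (Suc n)
  \<comment> \<open>Each term of the product rule keeps one undifferentiated factor, so the
    induction hypothesis also needs \<open>f\<close> and \<open>g\<close> themselves at order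
    \<open>n\<close>.\<close>
  have "cont_diff_on A f n" "cont_diff_on A g n"
    using Suc.prems by (auto intro: cont_diff_on_SucD)
  with Suc show ?case
    by (intro cont_diff_on_SucI[OF assms(2) bounded_bilinear.FDERIV[OF assms(1)
          cont_diff_on_has_derivative cont_diff_on_has_derivative]])
       (auto intro!: Suc.IH cont_diff_on_add assms(2))
qed

text \<open>The chain rule evaluates the derivative of \<open>g\<close> in the direction
  \<open>?f' x v\<close>, which varies with \<open>x\<close>, whereas \<open>cont_diff_on\<close>
  speaks of fixed directions only. Expanding that direction in \<open>Basis\<close> gives a finite
  sum of scalar coefficients times derivatives of \<open>g\<close> in fixed directions, to which the
  induction hypothesis applies.\<close>

lemma cont_diff_on_compose:
  fixes f :: "'a::real_normed_vector \<Rightarrow> 'b::euclidean_space"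
    and g :: "'b \<Rightarrow> 'c::real_normed_vector"
  assumes "open A" "f ` A \<subseteq> B" "cont_diff_on A f n" "cont_diff_on B g n"
  shows "cont_diff_on A (\<lambda>x. g (f x)) n"
  using assms(3,4)
proof (induction n arbitrary: g)
  case 0
  then show ?case using assms(2) by (auto intro: continuous_on_compose2)
next
  case (Suc n)
  let ?f' = "\<lambda>x. frechet_derivative f (at x)" and ?g' = "\<lambda>y. frechet_derivative g (at y)"
  have d: "((\<lambda>x. g (f x)) has_derivative (\<lambda>v. ?g' (f x) (?f' x v))) (at x)" if "x \<in> A" for x
    using Suc.prems assms(2) that
    by (intro has_derivative_compose[of f _ x UNIV g]) (auto simp: frechet_derivative_works)
  have "cont_diff_on A (\<lambda>x. ?g' (f x) (?f' x v)) n" for v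
  proof (rule cont_diff_on_cong[OF \<open>open A\<close>])
    have "cont_diff_on A f n"
      using Suc.prems(1) by (rule cont_diff_on_SucD)
    then show "cont_diff_on A (\<lambda>x. \<Sum>b\<in>Basis. (?f' x v \<bullet> b) *\<^sub>R ?g' (f x) b) n"
      using Suc.prems
      by (intro cont_diff_on_sum \<open>open A\<close> cont_diff_on_bilinear[OF bounded_bilinear_scaleR]
          cont_diff_on_bounded_linear[OF bounded_linear_inner_left] Suc.IH) auto
    fix x assume "x \<in> A"
    then interpret linear "?g' (f x)"
      using Suc.prems(2) assms(2) by (intro linear_frechet_derivative) auto
    have "(\<Sum>b\<in>Basis. (?f' x v \<bullet> b) *\<^sub>R ?g' (f x) b)
        = ?g' (f x) (\<Sum>b\<in>Basis. (?f' x v \<bullet> b) *\<^sub>R b)"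
      by (simp only: sum scale)
    then show "(\<Sum>b\<in>Basis. (?f' x v \<bullet> b) *\<^sub>R ?g' (f x) b) = ?g' (f x) (?f' x v)"
      by (simp only: euclidean_representation)
  qed
  with d show ?case by (rule cont_diff_on_SucI[OF \<open>open A\<close>])
qed

lemma smooth_on_open:
  assumes "open A"
  shows "smooth_on A f \<longleftrightarrow> (\<forall>n. cont_diff_on A f n)"
  unfolding smooth_on_def
  by (metis (no_types, lifting) assms cont_diff_on_cong cont_diff_on_subset order_refl)

text \<open>Freezing the time is composition with the affine map sending \<xi> to
  \<open>(\<xi>, t)\<close>, whose derivative is constant.\<close>

lemma smooth_on_slice:
  fixes U :: "real \<Rightarrow> real \<Rightarrow> 'a::real_normed_vector"
  assumes "open D" "smooth_on D (\<lambda>(x, t). U x t)"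
  shows "open {\<xi>. (\<xi>, t) \<in> D}" "smooth_on {\<xi>. (\<xi>, t) \<in> D} (\<lambda>\<xi>. U \<xi> t)"
proof -
  show o: "open {\<xi>. (\<xi>, t) \<in> D}"
    using open_vimage[OF \<open>open D\<close> continuous_on_Pair[OF continuous_on_id continuous_on_const]]
    by (simp add: vimage_def)
  have pair: "cont_diff_on A (\<lambda>\<xi>::real. (\<xi>, t)) n" if "open A" for A n
  proof (cases n)
    case (Suc m)
    have "((\<lambda>\<xi>::real. (\<xi>, t)) has_derivative (\<lambda>v. (v, 0))) (at y)" for y
      by (auto intro!: derivative_eq_intros)
    then show ?thesis
      unfolding Suc by (rule cont_diff_on_SucI[OF that _ cont_diff_on_const[OF that]])
  qed (auto intro!: continuous_intros)
  have "cont_diff_on D (\<lambda>(x, t). U x t) n" for n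
    using assms(2) unfolding smooth_on_open[OF \<open>open D\<close>] by blast
  then have "cont_diff_on {\<xi>. (\<xi>, t) \<in> D} (\<lambda>\<xi>. case (\<xi>, t) of (x, t) \<Rightarrow> U x t) n" for n
    by (intro cont_diff_on_compose[OF o _ pair[OF o]]) auto
  then show "smooth_on {\<xi>. (\<xi>, t) \<in> D} (\<lambda>\<xi>. U \<xi> t)"
    unfolding smooth_on_open[OF o] prod.case by (rule allI)
qed

section \<open>Nodes and reconstruction\<close>

lemma uniform_mesh_node:
  assumes "uniform_mesh h x"
  shows "x (i + j) = x i + of_int j * h"
proof (induction j rule: int_induct[where k = 0])
  case (step1 j)
  then show ?case
    using assms[unfolded uniform_mesh_def, rule_format, of "i + j"] by (simp add: algebra_simps)
next
  case (step2 j)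
  then show ?case
    using assms[unfolded uniform_mesh_def, rule_format, of "i + (j - 1)"]
    by (simp add: algebra_simps)
qed simp

text \<open>Only the values in the window matter, so agreement there suffices. This moves the node
  index to the origin, where \<open>reconstruction_order\<close> is stated.\<close>

lemma reconstruct_shift:
  assumes "\<And>j. j \<in> {l - int r..l + int s} \<Longrightarrow> v (i + j) = w j"
  shows "reconstruct R r s v (i + l) = reconstruct R r s w l"
proof -
  have "map v [i + l - int r..i + l + int s] = map w [l - int r..l + int s]"
  proof (rule nth_equalityI)
    fix n assume "n < length (map v [i + l - int r..i + l + int s])"
    then show "map v [i + l - int r..i + l + int s] ! n = map w [l - int r..l + int s] ! n"
      using assms[of "l - int r + int n"] by (simp add: nth_upto algebra_simps)
  qed simp
  then show ?thesis by (simp add: reconstruct_def)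
qed

theorem proposition1:
  fixes \<Omega> :: "(real^'n) set" and F S :: "real^'n \<Rightarrow> real^'n" and H :: "real \<Rightarrow> real"
    and R :: "(real^'n) list \<Rightarrow> real^'n" and r s k :: nat
    and D :: "(real \<times> real) set" and U :: "real \<Rightarrow> real \<Rightarrow> real^'n" and xbar t :: real
    and x :: "real \<Rightarrow> int \<Rightarrow> real" and i :: "real \<Rightarrow> int"
  assumes data: "balance_law_data \<Omega> F S H"
    and order: "reconstruction_order R r s k"
    and stationary_smooth: "\<And>I V. stationary_solution \<Omega> F S H I V \<Longrightarrow> smooth_on I V"
    and solution: "smooth_solution \<Omega> F S H D U"
    and point: "(xbar, t) \<in> D" and H_diff: "H differentiable (at xbar)"
    and mesh: "\<And>h. h > 0 \<Longrightarrow> uniform_mesh h (x h) \<and> x h (i h) = xbar"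
    and well_defined: "\<forall>\<^sub>F h in at_right 0.
      well_defined_method \<Omega> F S H r s {\<xi>. (\<xi>, t) \<in> D} (x h) (\<lambda>j. U (x h j) t)"
  shows "(\<lambda>h. norm (vector_derivative (\<lambda>\<tau>. U xbar \<tau>) (at t)
      + (1 / h) *\<^sub>R (numerical_flux_right R \<Omega> F S H r s (x h) (\<lambda>j. U (x h j) t) (i h)
                   - numerical_flux_left R \<Omega> F S H r s (x h) (\<lambda>j. U (x h j) t) (i h))))
    \<in> O[at_right 0](\<lambda>h. h ^ k)"
proof -
  have \<Omega>: "open \<Omega>" "\<And>n. cont_diff_on \<Omega> F n"
    using data smooth_on_open unfolding balance_law_data_def by blast+
  have D: "open D" "smooth_on D (\<lambda>(x, t). U x t)" "U xbar t \<in> \<Omega>"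
    "\<And>\<xi>. (\<xi>, t) \<in> D \<Longrightarrow> U \<xi> t \<in> \<Omega>"
    and law: "vector_derivative (\<lambda>\<tau>. U xbar \<tau>) (at t) + vector_derivative (\<lambda>\<xi>. F (U \<xi> t)) (at xbar)
          = deriv H xbar *\<^sub>R S (U xbar t)"
    using solution point H_diff unfolding smooth_solution_def by auto
  define A where "A = {\<xi>. (\<xi>, t) \<in> D}"
  have A: "open A" "xbar \<in> A" "\<And>n. cont_diff_on A (\<lambda>\<xi>. U \<xi> t) n"
    using smooth_on_slice[OF D(1,2), of t] smooth_on_open point by (auto simp: A_def)
  have FU: "cont_diff_on A (\<lambda>\<xi>. F (U \<xi> t)) n" for n
    by (rule cont_diff_on_compose[where B = \<Omega>]) (use A \<Omega> D(4) in \<open>auto simp: A_def\<close>)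

  \<comment> \<open>Choice of a reference step\<close>
  define u where "u h = (\<lambda>j. U (x h j) t)" for h
  \<comment> \<open>A positive bound for the absolute values of all stencil offsets, which range
    over \<open>{- 1 - int r..int s}\<close>.\<close>
  define m where "m = real r + real s + 1"
  have "m > 0" by (simp add: m_def)
  have node: "x h (i h + j) = xbar + of_int j * h" if "h > 0" for h j
    using uniform_mesh_node[of h "x h" "i h" j] mesh[OF that] by auto
  have stencil: "x h ` stencil r s (i h)
      = (\<lambda>j. xbar + of_int j * h) ` {- 1 - int r..int s}" if "h > 0" for h
  proof -
    have "stencil r s (i h) = (\<lambda>j. i h + j) ` {- 1 - int r..int s}"
      by (simp add: stencil_def)
    then show ?thesis using node[OF that] by (simp only: image_image)
  qed
  obtain e where "e > 0" and e: "ball xbar e \<subseteq> A"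
    using A openE by blast
  obtain b where "b > 0"
    and b: "\<And>h. 0 < h \<Longrightarrow> h < b \<Longrightarrow> well_defined_method \<Omega> F S H r s A (x h) (u h)"
    using well_defined unfolding eventually_at_right_field A_def u_def by blast
  \<comment> \<open>The first term puts \<open>h0\<close> strictly below \<open>b\<close>, where the
    method is well-defined; the second gives \<open>m * h0 < e\<close>, so that the stencils of all
    steps up to \<open>h0\<close> stay in the ball inside \<open>A\<close>.\<close>
  define h0 where "h0 = min (b / 2) (e / (2 * m))"
  have h0: "h0 > 0" "h0 < b" "m * h0 < e"
    using \<open>b > 0\<close> \<open>e > 0\<close> \<open>m > 0\<close> by (auto simp: h0_def min_def field_simps)
  have sub_A: "x h ` stencil r s (i h) \<subseteq> A" if "0 < h" "h \<le> h0" for h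
  proof -
    have "xbar + of_int j * h \<in> ball xbar e" if j: "j \<in> {- 1 - int r..int s}" for j
    proof -
      have "\<bar>of_int j :: real\<bar> \<le> m"
        using j by (auto simp: m_def)
      then have "\<bar>of_int j * h\<bar> \<le> m * h0"
        using \<open>0 < h\<close> \<open>h \<le> h0\<close> \<open>m > 0\<close> by (simp add: abs_mult mult_mono)
      then show ?thesis using h0 by (simp add: dist_norm)
    qed
    then show ?thesis using stencil[OF that(1)] e by auto
  qed

  \<comment> \<open>One stationary solution for all small steps\<close>
  have "\<exists>I V. stencil_solution \<Omega> F S H r s (x h0) (u h0) (i h0) I V"
    using b[OF h0(1,2), unfolded well_defined_method_def, rule_format, of "i h0"] sub_A[OF h0(1)]
    by simp
  then obtain I V where IV: "stencil_solution \<Omega> F S H r s (x h0) (u h0) (i h0) I V"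
    by (elim exE)
  then have statV: "stationary_solution \<Omega> F S H I V" and V0: "V xbar = U xbar t"
    and "x h0 ` stencil r s (i h0) \<subseteq> I"
    using mesh[OF h0(1)] by (auto simp: stencil_solution_def u_def)
  then have nodes0: "xbar + of_int j * h0 \<in> I" if "j \<in> {- 1 - int r..int s}" for j
    using imageI[OF that, of "\<lambda>j. xbar + of_int j * h0"] stencil[OF h0(1)] by blast
  \<comment> \<open>The leftmost stencil node for \<open>h0\<close>. The left flux reaches one node
    further than the right one, so \<open>a < xbar\<close> even for \<open>r = 0\<close>, and
    \<open>I\<close> always contains a nondegenerate interval to the left of
    \<open>xbar\<close>.\<close>
  define a where "a = xbar - (1 + real r) * h0"
  have "a < xbar" using h0(1) by (simp add: a_def)
  have I: "is_interval I" using statV by (simp add: stationary_solution_def)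
  have seg: "{a..xbar + real s * h0} \<subseteq> I"
    using mem_is_interval_1_I[OF I nodes0[of "- 1 - int r"] nodes0[of "int s"]]
    by (auto simp: a_def algebra_simps)
  have aI: "{a..xbar} \<subseteq> I"
    using order_trans[OF _ seg, of "{a..xbar}"] h0(1) by auto
  have "xbar \<in> I" using aI \<open>a < xbar\<close> by auto
  have nodes: "xbar + of_int j * h \<in> I" if "0 < h" "h \<le> h0" "j \<in> {- 1 - int r..int s}" for h j
  proof -
    have "of_int j * h \<le> real s * h"
      using that by (intro mult_right_mono) auto
    also have "\<dots> \<le> real s * h0"
      using that by (intro mult_left_mono) auto
    finally have up: "of_int j * h \<le> real s * h0" .
    have "- (of_int j) * h \<le> (1 + real r) * h"
      using that by (intro mult_right_mono) auto
    also have "\<dots> \<le> (1 + real r) * h0"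
      using that by (intro mult_left_mono) auto
    finally have "a \<le> xbar + of_int j * h" by (simp add: a_def)
    with up show ?thesis using seg by auto
  qed
  have local: "local_stationary \<Omega> F S H r s (x h) (u h) (i h) (x h (i h + j)) = V (xbar + of_int j * h)"
    if "0 < h" "h \<le> h0" "j \<in> {- 1 - int r..int s}" for h j
  proof -
    let ?W = "local_stationary \<Omega> F S H r s (x h) (u h) (i h)"
    have *: "stencil_solution \<Omega> F S H r s (x h) (u h) (i h) I V"
      using statV V0 nodes[OF that(1,2)] stencil[OF that(1)] mesh[OF that(1)]
      by (auto simp: stencil_solution_def u_def)
    then have "\<exists>V I. stencil_solution \<Omega> F S H r s (x h) (u h) (i h) I V" by blast
    \<comment> \<open>The function picked by \<open>SOME\<close> comes with its own interval
      \<open>J\<close>, which may differ from \<open>I\<close>. The stencil nodes lie in both, and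
      uniqueness on the intersection identifies the values there.\<close>
    then obtain J where J: "stencil_solution \<Omega> F S H r s (x h) (u h) (i h) J ?W"
      unfolding local_stationary_def by (rule someI_ex[THEN exE])
    then have "xbar + of_int j * h \<in> J"
      using imageI[OF that(3), of "\<lambda>j. xbar + of_int j * h"] stencil[OF that(1)]
      unfolding stencil_solution_def by blast
    moreover have "\<forall>y\<in>I \<inter> J. V y = ?W y"
    proof -
      have "h < b" using that(2) h0(2) by simp
      from b[OF that(1) this, unfolded well_defined_method_def, THEN spec, of "i h",
          THEN mp, OF sub_A[OF that(1,2)], THEN conjunct2]
      show ?thesis using * J by iprover
    qed
    ultimately show ?thesis using nodes[OF that] node[OF that(1)] by auto
  qed

  \<comment> \<open>A smooth function behind the fluctuations\<close>
  obtain B g where B: "open B" "I \<subseteq> B" "\<And>n. cont_diff_on B g n" and gV: "\<And>y. y \<in> I \<Longrightarrow> g y = V y"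
    using stationary_smooth[OF statV] unfolding smooth_on_def by blast
  \<comment> \<open>Off \<open>I\<close> the extension \<open>g\<close> may leave \<Omega>, where
    nothing is known about \<open>F\<close>. The preimage of \<Omega> is still an open neighbourhood
    of \<open>xbar\<close>, since \<open>g xbar = U xbar t\<close>.\<close>
  define C where "C = B \<inter> g -` \<Omega>"
  have C: "open C" "xbar \<in> C"
    using continuous_open_preimage[OF cont_diff_on_continuous[OF B(3)] B(1) \<Omega>(1)]
      \<open>xbar \<in> I\<close> B(2) gV V0 D(3) by (auto simp: C_def)
  have Fg: "cont_diff_on C (\<lambda>\<xi>. F (g \<xi>)) n" for n
    by (rule cont_diff_on_compose[where B = \<Omega>, OF C(1) _ cont_diff_on_subset[OF B(3)] \<Omega>(2)])
       (auto simp: C_def)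
  define G where "G \<xi> = F (U \<xi> t) - F (g \<xi>)" for \<xi>
  have smooth_G: "smooth_on (A \<inter> C) G"
    using cont_diff_on_diff[OF open_Int[OF A(1) C(1)] cont_diff_on_subset[OF FU]
        cont_diff_on_subset[OF Fg]] smooth_on_open[OF open_Int[OF A(1) C(1)]]
    unfolding G_def by auto

  \<comment> \<open>The derivative of \<open>G\<close> at \<open>xbar\<close>\<close>
  have dFg: "((\<lambda>\<xi>. F (g \<xi>)) has_vector_derivative vector_derivative (\<lambda>\<xi>. F (g \<xi>)) (at xbar)) (at xbar)"
    using Fg[of "Suc 0"] C(2) by (simp add: vector_derivative_works)
  have dFV: "((\<lambda>y. F (V y)) has_vector_derivative deriv H xbar *\<^sub>R S (V xbar)) (at xbar within {a..xbar})"
    using statV \<open>xbar \<in> I\<close> H_diff aI unfolding stationary_solution_def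
    by (blast intro: has_vector_derivative_within_subset)
  \<comment> \<open>\<open>g\<close> and \<open>V\<close> agree only on \<open>I\<close>, so the
    stationary equation is transferred within \<open>{a..xbar}\<close>. As \<open>a < xbar\<close>,
    derivatives within this interval are unique, and the two-sided derivative in \<open>dFg\<close>
    must have the same value.\<close>
  have "((\<lambda>y. F (g y)) has_vector_derivative deriv H xbar *\<^sub>R S (V xbar)) (at xbar within {a..xbar})"
    by (rule has_vector_derivative_transform[OF _ _ dFV]) (use aI \<open>a < xbar\<close> gV in auto)
  then have dFg': "vector_derivative (\<lambda>\<xi>. F (g \<xi>)) (at xbar) = deriv H xbar *\<^sub>R S (U xbar t)"
    using vector_derivative_unique_within_closed_interval[of a xbar xbar]
      has_vector_derivative_at_within[OF dFg, of "{a..xbar}"] \<open>a < xbar\<close> V0 by auto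
  have "((\<lambda>\<xi>. F (U \<xi> t)) has_vector_derivative vector_derivative (\<lambda>\<xi>. F (U \<xi> t)) (at xbar)) (at xbar)"
    using FU[of "Suc 0"] A(2) by (simp add: vector_derivative_works)
  from has_vector_derivative_diff[OF this dFg]
  have "vector_derivative G (at xbar)
      = vector_derivative (\<lambda>\<xi>. F (U \<xi> t)) (at xbar) - deriv H xbar *\<^sub>R S (U xbar t)"
    unfolding dFg' G_def[abs_def, symmetric] by (rule vector_derivative_at)
  then have dG: "vector_derivative G (at xbar) = - vector_derivative (\<lambda>\<tau>. U xbar \<tau>) (at t)"
    unfolding law[symmetric] by simp

  \<comment> \<open>Transfer of the reconstruction order to the numerical fluxes\<close>
  have eq: "reconstruct R r s (flux_fluctuation \<Omega> F S H r s (x h) (u h) (i h)) (i h + l)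
      = reconstruct R r s (\<lambda>j. G (xbar + of_int j * h)) l"
    \<comment> \<open>The offset \<open>0\<close> gives the right flux and \<open>-1\<close> the
      left one; their windows together are the whole stencil, whose nodes lie in \<open>I\<close>,
      where \<open>g\<close> is \<open>V\<close>.\<close>
    if h: "0 < h" "h \<le> h0" and l: "l \<in> {-1, 0}" for h l
  proof (rule reconstruct_shift)
    fix j assume "j \<in> {l - int r..l + int s}"
    with l have j: "j \<in> {- 1 - int r..int s}" by auto
    show "flux_fluctuation \<Omega> F S H r s (x h) (u h) (i h) (i h + j) = G (xbar + of_int j * h)"
      using local[OF h j] node[OF h(1)] gV[OF nodes[OF h j]]
      by (simp add: flux_fluctuation_def G_def u_def)
  qed
  have "(\<lambda>h. norm ((1 / h) *\<^sub>R (reconstruct R r s (\<lambda>j. G (xbar + of_int j * h)) 0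
          - reconstruct R r s (\<lambda>j. G (xbar + of_int j * h)) (-1)) - vector_derivative G (at xbar)))
        \<in> O[at_right 0](\<lambda>h. h ^ k)"
    using order[unfolded reconstruction_order_def, rule_format, of "A \<inter> C" G xbar] smooth_G A C
    by (simp add: interior_open open_Int)
  then show ?thesis
  proof (rule landau_o.big.in_cong[THEN iffD1, rotated])
    show "\<forall>\<^sub>F h in at_right 0. norm ((1 / h) *\<^sub>R (reconstruct R r s (\<lambda>j. G (xbar + of_int j * h)) 0
          - reconstruct R r s (\<lambda>j. G (xbar + of_int j * h)) (-1)) - vector_derivative G (at xbar))
      = norm (vector_derivative (\<lambda>\<tau>. U xbar \<tau>) (at t)
      + (1 / h) *\<^sub>R (numerical_flux_right R \<Omega> F S H r s (x h) (\<lambda>j. U (x h j) t) (i h)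
                   - numerical_flux_left R \<Omega> F S H r s (x h) (\<lambda>j. U (x h j) t) (i h)))"
      unfolding eventually_at_right_field u_def[symmetric]
        numerical_flux_right_def numerical_flux_left_def
      \<comment> \<open>The two norms coincide for all \<open>0 < h < h0\<close>; by
        \<open>dG\<close>, subtracting the derivative of \<open>G\<close> is adding the time
        derivative of \<open>U\<close>.\<close>
      using h0(1) eq[of _ 0] eq[of _ "-1"]
      by (intro exI[of _ h0]) (auto simp: dG add.commute)
  qed
qed

end
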